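(* There exists an absolute constant $C>0$ such that for all integers $n,t\geq 2$, $\log_2 A(t,n)\leq C\cdot \alpha(t,n)$.
   Context: For an integer $t\geq 2$ write $[t]=\{0,1,\dots,t-1\}$. The hypergrid $[t]^n$ is the poset on $[t]^n$ with the coordinate-wise order: $x\preceq y$ iff $x(i)\leq y(i)$ for all $i$. $\alpha(t,n)$ denotes the maximum size of an antichain in $[t]^n$, and $A(t,n)$ the number of antichains of $[t]^n$. *)

theory Defs
  imports Complex_Main "HOL-Library.FuncSet"
begin

text \<open>
  Points are extensional functions on \<open>{..<n}\<close>, so that HOL equality of
  points is equality of their \<open>n\<close> coordinates and there are exactly \<open>t ^ n\<close> of them.
\<close>

definition hypergrid :: "nat \<Rightarrow> nat \<Rightarrow> (nat \<Rightarrow> nat) set" where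
  "hypergrid t n = {..<n} \<rightarrow>\<^sub>E {..<t}"

definition grid_le :: "nat \<Rightarrow> (nat \<Rightarrow> nat) \<Rightarrow> (nat \<Rightarrow> nat) \<Rightarrow> bool" where
  "grid_le n x y \<longleftrightarrow> (\<forall>i<n. x i \<le> y i)"

definition antichains :: "nat \<Rightarrow> nat \<Rightarrow> (nat \<Rightarrow> nat) set set" where
  "antichains t n =
    {S. S \<subseteq> hypergrid t n \<and> (\<forall>x\<in>S. \<forall>y\<in>S. x \<noteq> y \<longrightarrow> \<not> grid_le n x y)}"

definition max_antichain_size :: "nat \<Rightarrow> nat \<Rightarrow> nat" where
  "max_antichain_size t n = Max (card ` antichains t n)"

definition num_antichains :: "nat \<Rightarrow> nat \<Rightarrow> nat" where
  "num_antichains t n = card (antichains t n)"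

lemma finite_hypergrid: "finite (hypergrid t n)"
  by (simp add: hypergrid_def finite_PiE)

lemma finite_antichains: "finite (antichains t n)"
  by (rule finite_subset[of _ "Pow (hypergrid t n)"])
    (auto simp: antichains_def finite_hypergrid)

lemma empty_in_antichains: "{} \<in> antichains t n"
  by (simp add: antichains_def)

end

theory Submission
  imports Defs "HOL-Analysis.Convex"
begin

text \<open>
  Split the \<open>n\<close> coordinates into two halves and decompose the grid of each half into chains, of sizes
  \<open>a\<^sub>i\<close> and \<open>b\<^sub>j\<close>. An antichain of \<open>[t]\<^sup>n\<close> is determined by its traces on the products of
  these chains, and a product of chains of sizes \<open>a\<close> and \<open>b\<close> has at most
  \<open>\<Sum>k. (a choose k) * (b choose k) \<le> exp (2 * sqrt (a * b))\<close> antichains. Hence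
  \<open>ln A(t,n) \<le> 2 * (\<Sum>i. sqrt a\<^sub>i) * (\<Sum>j. sqrt b\<^sub>j)\<close>. By Cauchy--Schwarz
  \<open>(\<Sum>i. sqrt a\<^sub>i)\<^sup>2\<close> is at most the size of the half grid times the number of its chains. For a
  symmetric chain decomposition of \<open>[t]\<^sup>m\<close> the latter is at most the size of the middle level, which
  is \<open>O(t\<^bsup>m-1\<^esup> / sqrt m)\<close> by a Littlewood--Offord argument. Therefore
  \<open>ln A(t,n) = O(t\<^bsup>n-1\<^esup> / sqrt n)\<close>. On the other hand \<open>\<alpha>(t,n)\<close> is at least of order
  \<open>t\<^bsup>n-1\<^esup> / sqrt n\<close>, since by Chebyshev's inequality most points lie on \<open>O(t * sqrt n)\<close> levels.
\<close>

section \<open>Symmetric chain decompositions\<close>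

abbreviation grid :: "nat \<Rightarrow> 'a set \<Rightarrow> ('a \<Rightarrow> nat) set" where
  "grid t I \<equiv> I \<rightarrow>\<^sub>E {..<t}"

lemma grid_insertE:
  assumes "x \<in> grid t (insert i I)" "i \<notin> I"
  obtains y j where "y \<in> grid t I" "j < t" "x = y(i := j)"
  using assms unfolding PiE_insert_eq by auto

lemma grid_upd: "y \<in> grid t I \<Longrightarrow> j < t \<Longrightarrow> y(i := j) \<in> grid t (insert i I)"
  by (rule PiE_fun_upd) auto

lemma sum_fun_upd_notin: "finite I \<Longrightarrow> i \<notin> I \<Longrightarrow> sum (y(i := j)) (insert i I) = sum y I + (j::nat)"
proof -
  assume "finite I" "i \<notin> I"
  moreover have "sum (y(i := j)) I = sum y I"
    using \<open>i \<notin> I\<close> by (intro sum.cong) auto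
  ultimately show ?thesis by simp
qed

lemma grid_restrict_upd:
  assumes "y \<in> grid t I" "i \<notin> I"
  shows "restrict (y(i := j)) I = y"
  by (simp only: restrict_fupd[OF assms(2)] PiE_restrict[OF assms(1)])

text \<open>
  A symmetric chain decomposition, encoded by the map \<open>\<phi>\<close> sending a point to the bottom of its
  chain: a chain with bottom of rank \<open>r\<close> meets every rank from \<open>r\<close> to \<open>card I * (t - 1) - r\<close>.
\<close>

definition symmetric_chain_label :: "nat \<Rightarrow> 'a set \<Rightarrow> (('a \<Rightarrow> nat) \<Rightarrow> ('a \<Rightarrow> nat)) \<Rightarrow> bool" where
  "symmetric_chain_label t I \<phi> \<longleftrightarrow> (\<forall>x\<in>grid t I.
     \<phi> x \<in> grid t I \<and>
     sum (\<phi> x) I \<le> sum x I \<and> sum x I + sum (\<phi> x) I \<le> card I * (t - 1) \<and>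
     (\<forall>y\<in>grid t I. \<phi> x = \<phi> y \<longrightarrow> sum x I \<le> sum y I \<longrightarrow> (\<forall>i\<in>I. x i \<le> y i)) \<and>
     (\<forall>k. sum (\<phi> x) I \<le> k \<longrightarrow> k + sum (\<phi> x) I \<le> card I * (t - 1) \<longrightarrow>
       (\<exists>y\<in>grid t I. \<phi> y = \<phi> x \<and> sum y I = k)))"

lemma symmetric_chain_labelD:
  assumes "symmetric_chain_label t I \<phi>" "x \<in> grid t I"
  shows "\<phi> x \<in> grid t I"
    and "sum (\<phi> x) I \<le> sum x I"
    and "sum x I + sum (\<phi> x) I \<le> card I * (t - 1)"
    and "\<lbrakk>y \<in> grid t I; \<phi> x = \<phi> y; sum x I \<le> sum y I\<rbrakk> \<Longrightarrow> \<forall>i\<in>I. x i \<le> y i"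
    and "\<lbrakk>sum (\<phi> x) I \<le> k; k + sum (\<phi> x) I \<le> card I * (t - 1)\<rbrakk> \<Longrightarrow>
      \<exists>y\<in>grid t I. \<phi> y = \<phi> x \<and> sum y I = k"
proof -
  note * = bspec[OF assms(1)[unfolded symmetric_chain_label_def] assms(2)]
  note ** = *[THEN conjunct2, THEN conjunct2, THEN conjunct2]
  show "\<phi> x \<in> grid t I" "sum (\<phi> x) I \<le> sum x I" "sum x I + sum (\<phi> x) I \<le> card I * (t - 1)"
    using * by simp_all
  show "\<forall>i\<in>I. x i \<le> y i" if "y \<in> grid t I" "\<phi> x = \<phi> y" "sum x I \<le> sum y I"
    using **[THEN conjunct1] that by blast
  show "\<exists>y\<in>grid t I. \<phi> y = \<phi> x \<and> sum y I = k"
    if "sum (\<phi> x) I \<le> k" "k + sum (\<phi> x) I \<le> card I * (t - 1)"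
    using **[THEN conjunct2] that by blast
qed

text \<open>
  The product of a chain of ranks \<open>r, \<dots>, M - r\<close> with \<open>{..<t}\<close> splits into hooks: hook \<open>s\<close> climbs along
  the old chain at height \<open>s\<close> up to rank \<open>M - r - s\<close>, and then along the new coordinate. So the point
  of rank \<open>u\<close> at height \<open>j\<close> lies on hook \<open>min j (M - r - u)\<close>.
\<close>

lemma hook_order:
  fixes u v j j' r M :: nat
  assumes "min j (M - r - u) = min j' (M - r - v)"
    and "u + r \<le> M" "v + r \<le> M" "u + j \<le> v + j'"
  shows "u \<le> v \<and> j \<le> j'"
  using assms by (auto simp: min_def split: if_splits)

text \<open>The bottom of hook \<open>s\<close> is the bottom of the old chain, of rank
  \<open>r\<close>, lifted to height \<open>s\<close>, so the new label is the old one with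
  \<open>s\<close> as new coordinate. The hook starts at rank \<open>r + s\<close> and ends at old
  rank \<open>M - r - s\<close> and height \<open>t - 1\<close>, which makes it symmetric
  again.\<close>

lemma symmetric_chain_label_insert:
  assumes fin: "finite I" and i: "i \<notin> I" and \<phi>: "symmetric_chain_label t I \<phi>"
  defines "\<phi>' \<equiv> \<lambda>x. let y = restrict x I in
     (\<phi> y)(i := min (x i) (card I * (t - 1) - sum (\<phi> y) I - sum y I))"
  shows "symmetric_chain_label t (insert i I) \<phi>'"
  unfolding symmetric_chain_label_def
proof (intro ballI conjI allI impI)
  let ?M = "card I * (t - 1)"
  have M': "card (insert i I) * (t - 1) = ?M + (t - 1)"
    using fin i by simp
  have \<phi>'_upd: "\<phi>' (y(i := j)) = (\<phi> y)(i := min j (?M - sum (\<phi> y) I - sum y I))"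
    if "y \<in> grid t I" for y j
    unfolding \<phi>'_def Let_def grid_restrict_upd[OF that i] by simp
  note sm = sum_fun_upd_notin[OF fin i]
  fix x assume x: "x \<in> grid t (insert i I)"
  then obtain x0 j where x0: "x0 \<in> grid t I" and j: "j < t" and xeq: "x = x0(i := j)"
    using i by (rule grid_insertE)
  define b where "b = \<phi> x0"
  define s where "s = min j (?M - sum b I - sum x0 I)"
  have \<phi>'x: "\<phi>' x = b(i := s)"
    using \<phi>'_upd[OF x0] by (simp add: xeq b_def s_def)
  note P = symmetric_chain_labelD[OF \<phi> x0, folded b_def]
  have s: "s < t" "s \<le> j" "s \<le> ?M - sum b I - sum x0 I"
    using j by (auto simp: s_def)
  show "\<phi>' x \<in> grid t (insert i I)"
    unfolding \<phi>'x by (rule grid_upd[OF P(1) s(1)])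
  have sums: "sum (\<phi>' x) (insert i I) = sum b I + s" "sum x (insert i I) = sum x0 I + j"
    unfolding \<phi>'x by (rule sm) (unfold xeq, rule sm)
  show "sum (\<phi>' x) (insert i I) \<le> sum x (insert i I)"
    unfolding sums using P(2) s by linarith
  show "sum x (insert i I) + sum (\<phi>' x) (insert i I) \<le> card (insert i I) * (t - 1)"
    unfolding sums M' using P(2,3) s j by linarith
  {
    fix y l assume y: "y \<in> grid t (insert i I)" and eq: "\<phi>' x = \<phi>' y"
      and le: "sum x (insert i I) \<le> sum y (insert i I)" and l: "l \<in> insert i I"
    obtain y0 j' where y0: "y0 \<in> grid t I" and j': "j' < t" and yeq: "y = y0(i := j')"
      using y i by (rule grid_insertE)
    note Q = symmetric_chain_labelD(1,3)[OF \<phi> y0]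
    have eq': "b(i := s) = (\<phi> y0)(i := min j' (?M - sum (\<phi> y0) I - sum y0 I))"
      using eq \<phi>'_upd[OF y0] by (simp add: \<phi>'x yeq)
    \<comment> \<open>Restriction to \<open>I\<close> shows that both points come from the same old
      chain; coordinate \<open>i\<close> of the label shows that they lie on the same hook.\<close>
    have b: "b = \<phi> y0"
      using grid_restrict_upd[OF P(1) i] grid_restrict_upd[OF Q(1) i] eq' by metis
    have s': "s = min j' (?M - sum b I - sum y0 I)"
      using fun_cong[OF eq', of i] b by simp
    have "sum x0 I + j \<le> sum y0 I + j'"
      using le unfolding sums unfolding yeq sm .
    then have "sum x0 I \<le> sum y0 I \<and> j \<le> j'"
      by (rule hook_order[OF trans[OF s_def[symmetric] s'] P(3) Q(2)[folded b]])
    then show "x l \<le> y l"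
      using P(4)[OF y0 b] l i by (auto simp: xeq yeq)
  }
  fix k assume k: "sum (\<phi>' x) (insert i I) \<le> k"
    "k + sum (\<phi>' x) (insert i I) \<le> card (insert i I) * (t - 1)"
  then have k': "sum b I + s \<le> k" "k + sum b I + s \<le> ?M + (t - 1)"
    unfolding sums M' by simp_all
  show "\<exists>y\<in>grid t (insert i I). \<phi>' y = \<phi>' x \<and> sum y (insert i I) = k"
  \<comment> \<open>Rank \<open>k\<close> is reached either while the hook still runs along the old
    chain at height \<open>s\<close>, or after its turn, along the new coordinate.\<close>
  proof (cases "k + sum b I \<le> ?M")
    case True
    have "sum b I \<le> k - s" "k - s + sum b I \<le> ?M"
      using k'(1) True by linarith+
    then obtain y0 where y0: "y0 \<in> grid t I" "\<phi> y0 = b" "sum y0 I = k - s"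
      using P(5) by blast
    have "min s (?M - sum b I - (k - s)) = s"
      using k'(1) True by linarith
    then have "\<phi>' (y0(i := s)) = \<phi>' x"
      unfolding \<phi>'_upd[OF y0(1)] \<phi>'x y0 by simp
    moreover have "sum (y0(i := s)) (insert i I) = k"
      unfolding sm y0 using k'(1) by simp
    moreover have "y0(i := s) \<in> grid t (insert i I)"
      by (rule grid_upd[OF y0(1) s(1)])
    ultimately show ?thesis by blast
  next
    case False
    \<comment> \<open>The old rank at which hook \<open>s\<close> turns; from there on only the new
      coordinate grows.\<close>
    define m where "m = ?M - sum b I - s"
    have m: "m + sum b I + s = ?M" "sum b I \<le> m"
      using P(2,3) s(3) unfolding m_def by linarith+
    then have "m + sum b I \<le> ?M"
      by linarith
    with m(2) obtain y0 where y0: "y0 \<in> grid t I" "\<phi> y0 = b" "sum y0 I = m"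
      using P(5) by blast
    have "?M - sum b I - m = s"
      unfolding m(1)[symmetric] by simp
    moreover have "m + s \<le> k"
      using m(1) False by linarith
    ultimately have "min (k - m) (?M - sum b I - m) = s"
      by simp
    then have "\<phi>' (y0(i := k - m)) = \<phi>' x"
      unfolding \<phi>'_upd[OF y0(1)] \<phi>'x y0 by simp
    moreover have "sum (y0(i := k - m)) (insert i I) = k"
      unfolding sm y0 using \<open>m + s \<le> k\<close> by simp
    moreover have "k - m < t"
      using k'(2) m(1) j by linarith
    then have "y0(i := k - m) \<in> grid t (insert i I)"
      by (rule grid_upd[OF y0(1)])
    ultimately show ?thesis by blast
  qed
qed

lemma symmetric_chain_label_exists:
  assumes "finite I"
  shows "\<exists>\<phi>. symmetric_chain_label t I \<phi>"
  using assms
proof (induction I rule: finite_induct)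
  case empty
  have "symmetric_chain_label t {} (\<lambda>x. x)"
    by (simp add: symmetric_chain_label_def)
  then show ?case by blast
next
  case (insert i I)
  from insert.IH obtain \<phi> where "symmetric_chain_label t I \<phi>" ..
  from symmetric_chain_label_insert[OF insert.hyps this] show ?case
    by - (rule exI)
qed

text \<open>All that counting needs: on each fibre the rank determines the order, that is, each
  fibre is a chain. Symmetry is dropped and labels may be of any type.\<close>

definition chain_label :: "nat \<Rightarrow> 'a set \<Rightarrow> (('a \<Rightarrow> nat) \<Rightarrow> 'b) \<Rightarrow> bool" where
  "chain_label t I \<phi> \<longleftrightarrow> (\<forall>x\<in>grid t I. \<forall>y\<in>grid t I.
     \<phi> x = \<phi> y \<longrightarrow> sum x I \<le> sum y I \<longrightarrow> (\<forall>i\<in>I. x i \<le> y i))"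

lemma finite_grid [simp]: "finite I \<Longrightarrow> finite (grid t I)"
  by (simp add: finite_PiE)

text \<open>A chain from rank \<open>r\<close> to rank \<open>M - r\<close> has
  \<open>2 * r \<le> M\<close>, so it contains a point of rank \<open>M div 2\<close>, for odd
  \<open>M\<close> too. Hence every label already occurs on the middle level.\<close>

lemma chain_label_middle:
  assumes "finite I"
  obtains \<phi> :: "('a \<Rightarrow> nat) \<Rightarrow> ('a \<Rightarrow> nat)" where "chain_label t I \<phi>"
    "card (\<phi> ` grid t I) \<le> card {x \<in> grid t I. sum x I = card I * (t - 1) div 2}"
proof -
  obtain \<phi> where \<phi>: "symmetric_chain_label t I \<phi>"
    using symmetric_chain_label_exists[OF assms] by blast
  let ?m = "card I * (t - 1) div 2"
  have "\<phi> ` grid t I \<subseteq> \<phi> ` {x \<in> grid t I. sum x I = ?m}"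
  proof
    fix c assume "c \<in> \<phi> ` grid t I"
    then obtain x where x: "x \<in> grid t I" "c = \<phi> x" by blast
    have "sum (\<phi> x) I + sum (\<phi> x) I \<le> card I * (t - 1)"
      using symmetric_chain_labelD(2,3)[OF \<phi> x(1)] by linarith
    then have "sum (\<phi> x) I \<le> ?m" "?m + sum (\<phi> x) I \<le> card I * (t - 1)"
      by linarith+
    then obtain y where "y \<in> grid t I" "\<phi> y = \<phi> x" "sum y I = ?m"
      using symmetric_chain_labelD(5)[OF \<phi> x(1)] by blast
    then show "c \<in> \<phi> ` {x \<in> grid t I. sum x I = ?m}"
      using x by (metis (mono_tags, lifting) image_eqI mem_Collect_eq)
  qed
  then have "card (\<phi> ` grid t I) \<le> card {x \<in> grid t I. sum x I = ?m}"
    using assms by (intro surj_card_le) auto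
  moreover have "chain_label t I \<phi>"
    unfolding chain_label_def using symmetric_chain_labelD(4)[OF \<phi>] by blast
  ultimately show thesis
    using that by blast
qed

lemma chain_labelD:
  "\<lbrakk>chain_label t I \<phi>; x \<in> grid t I; y \<in> grid t I; \<phi> x = \<phi> y; sum x I \<le> sum y I; i \<in> I\<rbrakk>
    \<Longrightarrow> x i \<le> y i"
  unfolding chain_label_def by blast

section \<open>The size of a level\<close>

lemma central_binomial_step:
  "(2 * Suc m choose Suc m) = 2 * (Suc (2 * m) choose m)"
  "(Suc (2 * m) choose m) * Suc m = Suc (2 * m) * (2 * m choose m)"
proof -
  have sym: "(Suc (2 * m) choose Suc m) = (Suc (2 * m) choose m)"
    using binomial_symmetric[of m "Suc (2 * m)"] by simp
  then show "(2 * Suc m choose Suc m) = 2 * (Suc (2 * m) choose m)"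
    by simp
  show "(Suc (2 * m) choose m) * Suc m = Suc (2 * m) * (2 * m choose m)"
    using Suc_times_binomial_eq[of "2 * m" m] sym by simp
qed

text \<open>Squaring avoids roots in the induction. Consecutive central coefficients have ratio
  \<open>2 * (2 * m + 1) / (m + 1)\<close>, so the step comes down to
  \<open>(2 * m + 1) * (2 * m + 3) \<le> 4 * (m + 1)^2\<close>.\<close>

lemma central_binomial_square_le: "real (2 * m choose m) ^ 2 * (2 * real m + 1) \<le> 16 ^ m"
proof (induction m)
  case 0
  then show ?case by simp
next
  case (Suc m)
  define B where "B = real (2 * m choose m)"
  define B' where "B' = real (2 * Suc m choose Suc m)"
  have rec: "B' * (real m + 1) = 2 * (2 * real m + 1) * B"
  proof -
    have "real ((Suc (2 * m) choose m) * Suc m) = real (Suc (2 * m) * (2 * m choose m))"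
      by (simp only: central_binomial_step(2))
    then have "real (Suc (2 * m) choose m) * (real m + 1) = (2 * real m + 1) * B"
      by (simp add: B_def algebra_simps)
    then show ?thesis
      unfolding B'_def central_binomial_step(1) by (simp add: algebra_simps)
  qed
  have "(B'\<^sup>2 * (2 * real m + 3)) * (real m + 1)\<^sup>2 = (B' * (real m + 1))\<^sup>2 * (2 * real m + 3)"
    by (simp add: power_mult_distrib)
  also have "\<dots> = (2 * (2 * real m + 1) * B)\<^sup>2 * (2 * real m + 3)"
    by (simp only: rec)
  also have "\<dots> = (4 * (2 * real m + 1) * (2 * real m + 3)) * (B\<^sup>2 * (2 * real m + 1))"
    by (simp add: power_mult_distrib power2_eq_square algebra_simps)
  also have "\<dots> \<le> (4 * (2 * real m + 1) * (2 * real m + 3)) * 16 ^ m"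
    using Suc.IH by (intro mult_left_mono) (auto simp: B_def)
  also have "\<dots> \<le> (16 * (real m + 1)\<^sup>2) * 16 ^ m"
    by (intro mult_right_mono) (auto simp: power2_eq_square algebra_simps)
  finally have "(B'\<^sup>2 * (2 * real m + 3)) * (real m + 1)\<^sup>2 \<le> 16 ^ Suc m * (real m + 1)\<^sup>2"
    by (simp add: algebra_simps)
  then have "B'\<^sup>2 * (2 * real m + 3) \<le> 16 ^ Suc m"
    by (rule mult_right_le_imp_le) auto
  then show ?case
    by (simp add: B'_def algebra_simps)
qed

lemma central_binomial_le: "real (2 * m choose m) * sqrt (2 * real m + 1) \<le> 4 ^ m"
proof (rule power2_le_imp_le)
  show "(real (2 * m choose m) * sqrt (2 * real m + 1))\<^sup>2 \<le> (4 ^ m)\<^sup>2"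
    using central_binomial_square_le[of m]
    by (simp add: power_mult_distrib power_mult[symmetric] mult.commute[of m] power_mult)
qed simp

lemma middle_binomial_le: "real (k choose (k div 2)) * sqrt (real k + 1) \<le> 2 ^ k"
proof (cases "even k")
  case True
  then obtain m where "k = 2 * m" by (elim evenE)
  then show ?thesis
    using central_binomial_le[of m] by (simp add: power_mult)
next
  case False
  then obtain m where k: "k = Suc (2 * m)" by (elim oddE) simp
  \<comment> \<open>Twice the odd middle coefficient is the next even one, so the even case applies
    after enlarging \<open>2 * m + 2\<close> to \<open>2 * m + 3\<close> under the root.\<close>
  have "2 * (real (Suc (2 * m) choose m) * sqrt (2 * real m + 2))
      \<le> 2 * (real (Suc (2 * m) choose m) * sqrt (2 * real (Suc m) + 1))"
    by (intro mult_left_mono) auto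
  also have "\<dots> = real (2 * Suc m choose Suc m) * sqrt (2 * real (Suc m) + 1)"
    by (simp only: central_binomial_step(1) of_nat_mult)
  also have "\<dots> \<le> 4 ^ Suc m"
    by (rule central_binomial_le)
  finally show ?thesis
    by (simp add: k power_mult add.commute)
qed

section \<open>Sperner's theorem for grids and the Littlewood-Offord bound\<close>

text \<open>An antichain meets each chain at most once, so the chain label is injective on it, and
  there are no more chains than points on the middle level.\<close>

lemma antichain_card_le_middle:
  assumes I: "finite I" and S: "S \<subseteq> grid t I"
    and anti: "\<And>x y. x \<in> S \<Longrightarrow> y \<in> S \<Longrightarrow> \<forall>i\<in>I. x i \<le> y i \<Longrightarrow> x = y"
  shows "card S \<le> card {x \<in> grid t I. sum x I = card I * (t - 1) div 2}"
proof -
  obtain \<phi> :: "('a \<Rightarrow> nat) \<Rightarrow> ('a \<Rightarrow> nat)" where \<phi>: "chain_label t I \<phi>"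
    "card (\<phi> ` grid t I) \<le> card {x \<in> grid t I. sum x I = card I * (t - 1) div 2}"
    by (rule chain_label_middle[OF I])
  have "inj_on \<phi> S"
  proof (rule inj_onI)
    fix x y assume xy: "x \<in> S" "y \<in> S" "\<phi> x = \<phi> y"
    then have g: "x \<in> grid t I" "y \<in> grid t I" using S by auto
    show "x = y"
    proof (cases "sum x I \<le> sum y I")
      case True
      then show ?thesis
        using anti[OF xy(1,2)] chain_labelD[OF \<phi>(1) g xy(3)] by blast
    next
      case False
      then have "sum y I \<le> sum x I" by simp
      then show ?thesis
        using anti[OF xy(2,1)] chain_labelD[OF \<phi>(1) g(2,1) xy(3)[symmetric]] by blast
    qed
  qed
  then have "card S = card (\<phi> ` S)"
    by (simp add: card_image)
  also have "\<dots> \<le> card (\<phi> ` grid t I)"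
    using S I by (intro card_mono) auto
  finally show ?thesis
    using \<phi>(2) by simp
qed

lemma card_binary_level_le:
  assumes I: "finite I"
  shows "card {x \<in> grid 2 I. sum x I = m} \<le> card I choose m"
proof -
  have "card {x \<in> grid 2 I. sum x I = m} \<le> card {K. K \<subseteq> I \<and> card K = m}"
  proof (rule card_inj_on_le[where f = "\<lambda>x. {i \<in> I. x i = 1}"])
    show "inj_on (\<lambda>x. {i \<in> I. x i = 1}) {x \<in> grid 2 I. sum x I = m}"
    proof (rule inj_onI)
      fix x y assume x: "x \<in> {x \<in> grid 2 I. sum x I = m}" and y: "y \<in> {x \<in> grid 2 I. sum x I = m}"
        and eq: "{i \<in> I. x i = 1} = {i \<in> I. y i = 1}"
      have "x \<in> grid 2 I" "y \<in> grid 2 I" using x y by auto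
      then show "x = y"
      proof (rule PiE_ext)
        fix i assume i: "i \<in> I"
        then have "x i < 2" "y i < 2" using x y by (auto simp: PiE_iff)
        moreover have "x i = 1 \<longleftrightarrow> y i = 1" using eq i by blast
        ultimately show "x i = y i" by linarith
      qed
    qed
    show "(\<lambda>x. {i \<in> I. x i = 1}) ` {x \<in> grid 2 I. sum x I = m} \<subseteq> {K. K \<subseteq> I \<and> card K = m}"
    proof clarify
      fix x assume x: "x \<in> grid 2 I"
      have "sum x I = (\<Sum>i\<in>I. if x i = 1 then 1 else 0)"
      proof (rule sum.cong)
        fix i assume "i \<in> I"
        then have "x i < 2" using x by (auto simp: PiE_iff)
        then show "x i = (if x i = 1 then 1 else 0)" by auto
      qed simp
      also have "\<dots> = card {i \<in> I. x i = 1}"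
        using I by (simp add: sum.If_cases Int_def)
      finally show "{i \<in> I. x i = 1} \<subseteq> I \<and> card {i \<in> I. x i = 1} = sum x I"
        by auto
    qed
    show "finite {K. K \<subseteq> I \<and> card K = m}"
      using I by simp
  qed
  then show ?thesis
    using I by (simp add: n_subsets)
qed

text \<open>The bit vectors counted form an antichain in the Boolean lattice.\<close>

lemma littlewood_offord_ordered:
  fixes L U :: "'a \<Rightarrow> nat"
  assumes J: "finite J" and gap: "\<And>i. i \<in> J \<Longrightarrow> L i + h \<le> U i"
  shows "card {e \<in> grid 2 J. (\<Sum>i\<in>J. if e i = 0 then L i else U i) \<in> {m..<m + h}}
    \<le> card J choose (card J div 2)"
proof -
  let ?f = "\<lambda>e i. if e i = 0 then L i else U i"
  let ?S = "{e \<in> grid 2 J. sum (?f e) J \<in> {m..<m + h}}"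
  have "card ?S \<le> card {x \<in> grid 2 J. sum x J = card J * (2 - 1) div 2}"
  proof (rule antichain_card_le_middle[OF J])
    fix x y assume x: "x \<in> ?S" and y: "y \<in> ?S" and le: "\<forall>i\<in>J. x i \<le> y i"
    show "x = y"
    proof (rule ccontr)
      assume "x \<noteq> y"
      have xg: "x \<in> grid 2 J" and yg: "y \<in> grid 2 J" using x y by auto
      obtain i where i: "i \<in> J" "x i \<noteq> y i"
        using PiE_ext[OF xg yg] \<open>x \<noteq> y\<close> by blast
      have "x i < y i" "y i < 2"
        using i le yg by (auto simp: PiE_iff order.strict_iff_order)
      then have "?f x i + h \<le> ?f y i"
        using gap[OF i(1)] by auto
      moreover have "sum (?f x) (J - {i}) \<le> sum (?f y) (J - {i})"
      proof (rule sum_mono)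
        fix j assume "j \<in> J - {i}"
        then have "x j \<le> y j" "L j \<le> U j"
          using le gap[of j] by auto
        then show "?f x j \<le> ?f y j" by auto
      qed
      \<comment> \<open>Raising one bit already moves the sum by \<open>h\<close>, whereas two
        members of a window of \<open>h\<close> consecutive integers differ by less.\<close>
      ultimately have "sum (?f x) J + h \<le> sum (?f y) J"
        unfolding sum.remove[OF J i(1)] by linarith
      then show False using x y by auto
    qed
  qed auto
  also have "\<dots> \<le> card J choose (card J div 2)"
    using card_binary_level_le[OF J, of "card J div 2"] by simp
  finally show ?thesis .
qed

text \<open>Flipping the bits at coordinates with \<open>b i < a i\<close> is injective and
  preserves the sum once \<open>a i\<close> and \<open>b i\<close> are sorted, which reduces to the
  ordered case.\<close>

lemma littlewood_offord:
  fixes a b :: "'a \<Rightarrow> nat"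
  assumes J: "finite J" and gap: "\<And>i. i \<in> J \<Longrightarrow> a i + h \<le> b i \<or> b i + h \<le> a i"
  shows "card {e \<in> grid 2 J. (\<Sum>i\<in>J. if e i = 0 then a i else b i) \<in> {m..<m + h}}
    \<le> card J choose (card J div 2)"
proof -
  let ?L = "\<lambda>i. min (a i) (b i)" and ?U = "\<lambda>i. max (a i) (b i)"
  define flip where "flip e = (\<lambda>i\<in>J. if a i \<le> b i then e i else 1 - e i)" for e :: "'a \<Rightarrow> nat"
  have "card {e \<in> grid 2 J. (\<Sum>i\<in>J. if e i = 0 then a i else b i) \<in> {m..<m + h}}
    \<le> card {e \<in> grid 2 J. (\<Sum>i\<in>J. if e i = 0 then ?L i else ?U i) \<in> {m..<m + h}}"
  proof (rule card_inj_on_le[where f = flip])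
    show "inj_on flip {e \<in> grid 2 J. (\<Sum>i\<in>J. if e i = 0 then a i else b i) \<in> {m..<m + h}}"
    proof (rule inj_onI)
      fix x y assume x: "x \<in> {e \<in> grid 2 J. (\<Sum>i\<in>J. if e i = 0 then a i else b i) \<in> {m..<m + h}}"
        and y: "y \<in> {e \<in> grid 2 J. (\<Sum>i\<in>J. if e i = 0 then a i else b i) \<in> {m..<m + h}}"
        and eq: "flip x = flip y"
      have g: "x \<in> grid 2 J" "y \<in> grid 2 J" using x y by auto
      then show "x = y"
      proof (rule PiE_ext)
        fix i assume i: "i \<in> J"
        then have "x i < 2" "y i < 2" using g by (auto simp: PiE_iff)
        moreover have "(if a i \<le> b i then x i else 1 - x i) = (if a i \<le> b i then y i else 1 - y i)"
          using fun_cong[OF eq, of i] i by (simp add: flip_def)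
        ultimately show "x i = y i" by (auto split: if_splits)
      qed
    qed
    show "flip ` {e \<in> grid 2 J. (\<Sum>i\<in>J. if e i = 0 then a i else b i) \<in> {m..<m + h}}
      \<subseteq> {e \<in> grid 2 J. (\<Sum>i\<in>J. if e i = 0 then ?L i else ?U i) \<in> {m..<m + h}}"
    proof (rule image_subsetI)
      fix e assume e: "e \<in> {e \<in> grid 2 J. (\<Sum>i\<in>J. if e i = 0 then a i else b i) \<in> {m..<m + h}}"
      have lt: "e i < 2" if "i \<in> J" for i
        using e that by (auto simp: PiE_iff)
      have "flip e \<in> grid 2 J"
        unfolding flip_def by (rule restrict_PiE_iff[THEN iffD2]) (use lt in auto)
      moreover have "(\<Sum>i\<in>J. if flip e i = 0 then ?L i else ?U i) = (\<Sum>i\<in>J. if e i = 0 then a i else b i)"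
      proof (rule sum.cong)
        fix i assume "i \<in> J"
        with lt[OF this] show "(if flip e i = 0 then ?L i else ?U i) = (if e i = 0 then a i else b i)"
          by (auto simp: flip_def)
      qed simp
      ultimately show "flip e \<in> {e \<in> grid 2 J. (\<Sum>i\<in>J. if e i = 0 then ?L i else ?U i) \<in> {m..<m + h}}"
        using e by simp
    qed
    show "finite {e \<in> grid 2 J. (\<Sum>i\<in>J. if e i = 0 then ?L i else ?U i) \<in> {m..<m + h}}"
      using J by simp
  qed
  also have "\<dots> \<le> card J choose (card J div 2)"
    by (rule littlewood_offord_ordered[OF J]) (use gap in fastforce)
  finally show ?thesis .
qed

text \<open>Without wrapping the value rises by \<open>h\<close>; with wrapping it falls by
  \<open>t - h\<close>, which is at least \<open>h\<close>.\<close>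

lemma rotate_gap:
  fixes z h t :: nat
  assumes "z < t" "2 * h \<le> t"
  shows "z + h \<le> (z + h) mod t \<or> (z + h) mod t + h \<le> z"
proof (cases "z + h < t")
  case False
  then have "(z + h) mod t = z + h - t"
    using assms by (simp add: mod_if)
  then show ?thesis using False assms by linarith
qed simp

lemma card_grid: "finite I \<Longrightarrow> card (grid t I) = t ^ card I"
  by (simp add: card_PiE)

text \<open>
  A uniform point of the grid is obtained from a uniform \<open>z\<close> and uniform bits \<open>e\<close> by rotating the
  coordinates with \<open>e i = 1\<close> by \<open>h\<close> modulo \<open>t\<close>. For fixed \<open>z\<close> each bit changes the rank by at least
  \<open>h\<close>, which makes the Littlewood--Offord bound applicable.
\<close>

lemma card_window_le:
  assumes J: "finite J" and h: "2 * h \<le> t" "0 < t"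
  shows "card {y \<in> grid t J. sum y J \<in> {m..<m + h}} * 2 ^ card J
    \<le> t ^ card J * (card J choose (card J div 2))"
proof -
  let ?W = "{y \<in> grid t J. sum y J \<in> {m..<m + h}}"
  let ?E = "\<lambda>z. {e \<in> grid 2 J. (\<Sum>i\<in>J. if e i = 0 then z i else (z i + h) mod t) \<in> {m..<m + h}}"
  \<comment> \<open>Adding \<open>t - h\<close> modulo \<open>t\<close> undoes the rotation by
    \<open>h\<close>: the marked coordinates of \<open>y\<close> are rotated back to give
    \<open>z\<close>, and \<open>e\<close> is kept, so that \<open>y\<close> can be recovered from
    the pair.\<close>
  define rot where "rot = (\<lambda>(y, e :: 'a \<Rightarrow> nat). (\<lambda>i\<in>J. if e i = 0 then y i else (y i + (t - h)) mod t, e))"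
  have unrot: "((u + (t - h)) mod t + h) mod t = u" if "u < t" for u
    using that h by (simp add: mod_simps)
  have "card (?W \<times> grid 2 J) \<le> card (SIGMA z:grid t J. ?E z)"
  proof (rule card_inj_on_le[where f = rot])
    show "inj_on rot (?W \<times> grid 2 J)"
    proof (rule inj_onI)
      fix p q assume p: "p \<in> ?W \<times> grid 2 J" and q: "q \<in> ?W \<times> grid 2 J" and eq: "rot p = rot q"
      obtain y e where pe: "p = (y, e)" by force
      obtain y' e' where qe: "q = (y', e')" by force
      have e: "e' = e" using eq by (simp add: pe qe rot_def)
      have g: "y \<in> grid t J" "y' \<in> grid t J" using p q pe qe by auto
      then have "y = y'"
      proof (rule PiE_ext)
        fix i assume i: "i \<in> J"
        then have lt: "y i < t" "y' i < t" using g by (auto simp: PiE_iff)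
        have "(if e i = 0 then y i else (y i + (t - h)) mod t)
            = (if e i = 0 then y' i else (y' i + (t - h)) mod t)"
          using fun_cong[of _ _ i, OF arg_cong[OF eq, of fst]] i by (simp add: pe qe rot_def e)
        then show "y i = y' i"
          using unrot[OF lt(1)] unrot[OF lt(2)] by metis
      qed
      then show "p = q" using pe qe e by simp
    qed
    show "rot ` (?W \<times> grid 2 J) \<subseteq> (SIGMA z:grid t J. ?E z)"
    proof (rule image_subsetI)
      fix p assume p: "p \<in> ?W \<times> grid 2 J"
      obtain y e where pe: "p = (y, e)" by force
      have y: "y \<in> grid t J" "sum y J \<in> {m..<m + h}" and e: "e \<in> grid 2 J"
        using p pe by auto
      define z where "z = (\<lambda>i\<in>J. if e i = 0 then y i else (y i + (t - h)) mod t)"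
      have lt: "y i < t" if "i \<in> J" for i using y that by (auto simp: PiE_iff)
      have "z \<in> grid t J"
        unfolding z_def by (rule restrict_PiE_iff[THEN iffD2]) (use lt h in auto)
      moreover have "(\<Sum>i\<in>J. if e i = 0 then z i else (z i + h) mod t) = sum y J"
        by (rule sum.cong) (auto simp: z_def unrot[OF lt])
      moreover have "rot p = (z, e)"
        by (simp add: pe rot_def z_def)
      ultimately show "rot p \<in> (SIGMA z:grid t J. ?E z)"
        using y(2) e by simp
    qed
    show "finite (SIGMA z:grid t J. ?E z)"
      using J by (intro finite_SigmaI) auto
  qed
  also have "card (SIGMA z:grid t J. ?E z) = (\<Sum>z\<in>grid t J. card (?E z))"
    using J by (intro card_SigmaI) auto
  also have "\<dots> \<le> (\<Sum>z\<in>grid t J. card J choose (card J div 2))"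
  proof (rule sum_mono)
    fix z assume z: "z \<in> grid t J"
    show "card (?E z) \<le> card J choose (card J div 2)"
      by (rule littlewood_offord[OF J]) (use rotate_gap z h in \<open>auto simp: PiE_iff\<close>)
  qed
  also have "\<dots> = t ^ card J * (card J choose (card J div 2))"
    using J by (simp add: card_grid)
  finally show ?thesis
    using J by (simp add: card_cartesian_product card_grid)
qed

text \<open>On a level, coordinate \<open>i\<close> is determined by the others, whose sum is
  \<open>m\<close> minus a number below \<open>t\<close>. If \<open>m + 1 < t\<close>, subtraction
  truncates and the window \<open>{0..<t}\<close> still contains all sums up to
  \<open>m\<close>.\<close>

lemma card_level_le_window:
  assumes I: "finite I" "i \<in> I"
  shows "card {x \<in> grid t I. sum x I = m}
    \<le> card {y \<in> grid t (I - {i}). sum y (I - {i}) \<in> {m + 1 - t..<m + 1 - t + t}}"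
proof (rule card_inj_on_le[where f = "\<lambda>x. restrict x (I - {i})"])
  let ?J = "I - {i}"
  have split: "sum x I = sum (restrict x ?J) ?J + x i" for x :: "'a \<Rightarrow> nat"
    using I by (simp add: sum.remove[OF I])
  show "inj_on (\<lambda>x. restrict x ?J) {x \<in> grid t I. sum x I = m}"
  proof (rule inj_onI)
    fix x y assume x: "x \<in> {x \<in> grid t I. sum x I = m}" and y: "y \<in> {x \<in> grid t I. sum x I = m}"
      and eq: "restrict x ?J = restrict y ?J"
    have "x i = y i"
      using x y split[of x] split[of y] eq by simp
    moreover have "x j = y j" if "j \<in> ?J" for j
      using fun_cong[OF eq, of j] that by simp
    moreover have "x \<in> grid t I" "y \<in> grid t I" using x y by auto
    ultimately show "x = y"
      using PiE_ext[of x I _ y] by blast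
  qed
  show "(\<lambda>x. restrict x ?J) ` {x \<in> grid t I. sum x I = m}
      \<subseteq> {y \<in> grid t ?J. sum y ?J \<in> {m + 1 - t..<m + 1 - t + t}}"
  proof (rule image_subsetI)
    fix x assume x: "x \<in> {x \<in> grid t I. sum x I = m}"
    have "x i < t" using x I by (auto simp: PiE_iff)
    moreover have "sum (restrict x ?J) ?J + x i = m" using x split by simp
    ultimately have "sum (restrict x ?J) ?J \<in> {m + 1 - t..<m + 1 - t + t}" by auto
    moreover have "restrict x ?J \<in> grid t ?J"
      using x by (auto simp: restrict_PiE_iff PiE_iff)
    ultimately show "restrict x ?J \<in> {y \<in> grid t ?J. sum y ?J \<in> {m + 1 - t..<m + 1 - t + t}}"
      by blast
  qed
qed (use I in simp)

lemma card_level_le: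
  assumes I: "finite I" "I \<noteq> {}" and t: "2 \<le> t"
  shows "real (card {x \<in> grid t I. sum x I = m}) * sqrt (card I) \<le> 3 * real t ^ (card I - 1)"
proof -
  obtain i where i: "i \<in> I" using I by blast
  define J where "J = I - {i}"
  define h where "h = t div 2"
  have J: "finite J" using I by (simp add: J_def)
  have cI: "card I = card J + 1"
    unfolding J_def using card.remove[OF I(1) i] by linarith
  \<comment> \<open>Rotation requires \<open>2 * h \<le> t\<close>. Three windows of length
    \<open>h\<close> cover one of length \<open>t\<close>, the worst case being
    \<open>t = 3\<close>; this is the source of the factor 3.\<close>
  have h: "2 * h \<le> t" "t \<le> 3 * h" using t unfolding h_def by linarith+
  let ?W = "\<lambda>m. {y \<in> grid t J. sum y J \<in> {m..<m + h}}"
  let ?b = "card J choose (card J div 2)"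
  define m0 where "m0 = m + 1 - t"
  have "card {x \<in> grid t I. sum x I = m} \<le> card {y \<in> grid t J. sum y J \<in> {m0..<m0 + t}}"
    using card_level_le_window[OF I(1) i] by (simp add: J_def m0_def)
  also have "\<dots> \<le> card (?W m0 \<union> ?W (m0 + h) \<union> ?W (m0 + 2 * h))"
    using J h by (intro card_mono) auto
  also have "\<dots> \<le> card (?W m0) + card (?W (m0 + h)) + card (?W (m0 + 2 * h))"
    by (meson add_le_mono1 card_Un_le order_trans)
  finally have "card {x \<in> grid t I. sum x I = m} * 2 ^ card J
      \<le> (card (?W m0) + card (?W (m0 + h)) + card (?W (m0 + 2 * h))) * 2 ^ card J"
    by (rule mult_right_mono) simp
  also have "\<dots> \<le> 3 * (t ^ card J * ?b)"
    using card_window_le[OF J h(1), of m0] card_window_le[OF J h(1), of "m0 + h"]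
      card_window_le[OF J h(1), of "m0 + 2 * h"] t
    unfolding distrib_right by linarith
  finally have "real (card {x \<in> grid t I. sum x I = m} * 2 ^ card J) \<le> real (3 * (t ^ card J * ?b))"
    by (rule of_nat_mono)
  then have "(real (card {x \<in> grid t I. sum x I = m}) * 2 ^ card J) * sqrt (real (card J) + 1)
      \<le> (3 * (real t ^ card J * ?b)) * sqrt (real (card J) + 1)"
    by (intro mult_right_mono) auto
  also have "\<dots> = 3 * real t ^ card J * (?b * sqrt (real (card J) + 1))"
    by (simp only: mult.assoc)
  also have "\<dots> \<le> 3 * real t ^ card J * 2 ^ card J"
    by (intro mult_left_mono middle_binomial_le) simp
  finally have "(real (card {x \<in> grid t I. sum x I = m}) * sqrt (card I)) * 2 ^ card J
      \<le> (3 * real t ^ (card I - 1)) * 2 ^ card J"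
    by (simp add: cI mult_ac add_ac)
  then show ?thesis
    by (rule mult_right_le_imp_le) simp
qed

section \<open>A lower bound for the largest level\<close>

lemma sum_grid_insert:
  assumes "finite I" "i \<notin> I"
  shows "(\<Sum>x\<in>grid t (insert i I). f x) = (\<Sum>y\<in>grid t I. \<Sum>j<t. f (y(i := j)))"
proof -
  have "(\<Sum>x\<in>grid t (insert i I). f x) = (\<Sum>(j, y)\<in>{..<t} \<times> grid t I. f (y(i := j)))"
    unfolding PiE_insert_eq using inj_combinator[OF assms(2), of "\<lambda>_. {..<t}"]
    by (subst sum.reindex) (auto simp: case_prod_beta intro: sum.cong)
  also have "\<dots> = (\<Sum>j<t. \<Sum>y\<in>grid t I. f (y(i := j)))"
    by (simp add: sum.cartesian_product)
  also have "\<dots> = (\<Sum>y\<in>grid t I. \<Sum>j<t. f (y(i := j)))"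
    by (rule sum.swap)
  finally show ?thesis .
qed

lemma sum_centred: "(\<Sum>j<t. 2 * real j - (real t - 1)) = 0"
proof -
  have "(\<Sum>j<t. 2 * real j) = real t * (real t - 1)"
    by (induction t) (auto simp: algebra_simps)
  then show ?thesis
    by (simp add: sum_subtractf)
qed

text \<open>The variance of the rank of a uniform point, doubled before centring to avoid halves.
  Adding a coordinate produces a cross term that sums to zero and a square of at most
  \<open>t^2\<close> for each of its values.\<close>

lemma second_moment_le:
  assumes "finite I"
  shows "(\<Sum>x\<in>grid t I. (2 * real (sum x I) - real (card I) * (real t - 1))\<^sup>2)
    \<le> real (card I) * (real t)\<^sup>2 * real t ^ card I"
  using assms
proof (induction I rule: finite_induct)
  case empty
  then show ?case by simp
next
  case (insert i I)
  let ?X = "\<lambda>x. 2 * real (sum x I) - real (card I) * (real t - 1)"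
  let ?D = "\<lambda>j. 2 * real j - (real t - 1)"
  have D2: "(\<Sum>j<t. (?D j)\<^sup>2) \<le> real t * (real t)\<^sup>2"
  proof -
    have "(\<Sum>j<t. (?D j)\<^sup>2) \<le> (\<Sum>j<t. (real t)\<^sup>2)"
    proof (rule sum_mono)
      fix j assume "j \<in> {..<t}"
      then have "real j + 1 \<le> real t" by auto
      then have "\<bar>?D j\<bar> \<le> \<bar>real t\<bar>" by (auto simp: abs_if)
      then show "(?D j)\<^sup>2 \<le> (real t)\<^sup>2" by (simp only: abs_le_square_iff)
    qed
    then show ?thesis by simp
  qed
  have step: "(\<Sum>j<t. (?X y + ?D j)\<^sup>2) \<le> real t * (?X y)\<^sup>2 + real t * (real t)\<^sup>2" for y
  proof -
    have "(\<Sum>j<t. (?X y + ?D j)\<^sup>2) = (\<Sum>j<t. (?X y)\<^sup>2 + (2 * ?X y) * ?D j + (?D j)\<^sup>2)"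
      by (intro sum.cong refl) (simp only: power2_sum ac_simps)
    also have "\<dots> = real t * (?X y)\<^sup>2 + (2 * ?X y) * (\<Sum>j<t. ?D j) + (\<Sum>j<t. (?D j)\<^sup>2)"
      unfolding sum.distrib sum_distrib_left by simp
    finally show ?thesis
      using D2 unfolding sum_centred by linarith
  qed
  have "(\<Sum>x\<in>grid t (insert i I).
      (2 * real (sum x (insert i I)) - real (card (insert i I)) * (real t - 1))\<^sup>2)
      = (\<Sum>y\<in>grid t I. \<Sum>j<t. (?X y + ?D j)\<^sup>2)"
    unfolding sum_grid_insert[OF insert.hyps] sum_fun_upd_notin[OF insert.hyps]
    using insert.hyps by (intro sum.cong refl arg_cong[where f = "\<lambda>u. u\<^sup>2"]) (simp add: algebra_simps)
  also have "\<dots> \<le> (\<Sum>y\<in>grid t I. real t * (?X y)\<^sup>2 + real t * (real t)\<^sup>2)"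
    by (intro sum_mono step)
  also have "\<dots> = real t * (\<Sum>y\<in>grid t I. (?X y)\<^sup>2) + real t ^ card I * (real t * (real t)\<^sup>2)"
    using insert.hyps by (simp add: sum.distrib sum_distrib_left card_PiE)
  also have "\<dots> \<le> real t * (real (card I) * (real t)\<^sup>2 * real t ^ card I)
      + real t ^ card I * (real t * (real t)\<^sup>2)"
    using insert.IH by (intro add_right_mono mult_left_mono) auto
  also have "\<dots> = real (card (insert i I)) * (real t)\<^sup>2 * real t ^ card (insert i I)"
    using insert.hyps by (simp add: algebra_simps)
  finally show ?case .
qed

text \<open>By Chebyshev's inequality at most a quarter of the points have rank at distance
  \<open>w = t * sqrt n\<close> or more from the mean. The others occupy at most
  \<open>3 * w\<close> levels, each of size at most \<open>\<alpha>\<close>.\<close>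

lemma power_le_if_levels_le:
  assumes I: "finite I" and t: "1 \<le> t" and ne: "I \<noteq> {}"
    and \<alpha>: "\<And>k. card {x \<in> grid t I. sum x I = k} \<le> \<alpha>"
  shows "real t ^ card I \<le> 6 * real t * sqrt (card I) * real \<alpha>"
proof -
  define n where "n = card I"
  define w where "w = real t * sqrt n"
  let ?X = "\<lambda>k. 2 * real k - real n * (real t - 1)"
  let ?near = "{x \<in> grid t I. \<bar>?X (sum x I)\<bar> < 2 * w}"
  let ?far = "{x \<in> grid t I. \<not> \<bar>?X (sum x I)\<bar> < 2 * w}"
  have n: "1 \<le> n" using I ne by (simp add: n_def Suc_le_eq card_gt_0_iff)
  have "1 * 1 \<le> real t * sqrt n"
    using t n by (intro mult_mono) auto
  then have w: "1 \<le> w" by (simp add: w_def)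
  have w2: "w\<^sup>2 = real n * (real t)\<^sup>2"
    by (simp add: w_def power_mult_distrib mult.commute)
  have "4 * w\<^sup>2 * card ?far = (\<Sum>x\<in>?far. (2 * w)\<^sup>2)"
    by simp
  also have "\<dots> \<le> (\<Sum>x\<in>?far. (?X (sum x I))\<^sup>2)"
  proof (rule sum_mono)
    fix x assume "x \<in> ?far"
    then have "\<bar>2 * w\<bar> \<le> \<bar>?X (sum x I)\<bar>" using w by simp
    then show "(2 * w)\<^sup>2 \<le> (?X (sum x I))\<^sup>2" by (simp only: abs_le_square_iff)
  qed
  also have "\<dots> \<le> (\<Sum>x\<in>grid t I. (?X (sum x I))\<^sup>2)"
    using I by (intro sum_mono2) auto
  also have "\<dots> \<le> w\<^sup>2 * real t ^ n"
    using second_moment_le[OF I, of t] by (simp add: n_def w2)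
  finally have "w\<^sup>2 * (4 * card ?far) \<le> w\<^sup>2 * real t ^ n"
    by (simp add: mult_ac)
  then have far: "4 * real (card ?far) \<le> real t ^ n"
    using w by (simp add: mult_le_cancel_left)
  \<comment> \<open>The range of ranks is taken in the integers since \<open>lo\<close> may be
    negative; \<open>nat\<close> then sends negative values to 0 and does not enlarge the set. It
    has at most \<open>2 * w + 1 \<le> 3 * w\<close> elements, by \<open>1 \<le> w\<close>.\<close>
  define lo where "lo = \<lceil>real n * (real t - 1) / 2 - w\<rceil>"
  define hi where "hi = \<lfloor>real n * (real t - 1) / 2 + w\<rfloor>"
  have "card ?near \<le> card (\<Union>k\<in>nat ` {lo..hi}. {x \<in> grid t I. sum x I = k})"
  proof (rule card_mono)
    show "finite (\<Union>k\<in>nat ` {lo..hi}. {x \<in> grid t I. sum x I = k})"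
      using I by auto
    show "?near \<subseteq> (\<Union>k\<in>nat ` {lo..hi}. {x \<in> grid t I. sum x I = k})"
    proof
      fix x assume x: "x \<in> ?near"
      have "int (sum x I) \<in> {lo..hi}"
        using x unfolding lo_def hi_def atLeastAtMost_iff ceiling_le_iff le_floor_iff
        by (auto simp: abs_less_iff)
      then have "sum x I \<in> nat ` {lo..hi}"
        by (metis image_eqI nat_int)
      then show "x \<in> (\<Union>k\<in>nat ` {lo..hi}. {x \<in> grid t I. sum x I = k})"
        using x by auto
    qed
  qed
  also have "\<dots> \<le> (\<Sum>k\<in>nat ` {lo..hi}. card {x \<in> grid t I. sum x I = k})"
    by (rule card_UN_le) simp
  also have "\<dots> \<le> card (nat ` {lo..hi}) * \<alpha>"
    using sum_bounded_above[of "nat ` {lo..hi}" "\<lambda>k. card {x \<in> grid t I. sum x I = k}" \<alpha>] \<alpha> by simp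
  also have "\<dots> \<le> card {lo..hi} * \<alpha>"
    by (intro mult_right_mono card_image_le) auto
  finally have "real (card ?near) \<le> real (card {lo..hi} * \<alpha>)"
    by (rule of_nat_mono)
  also have "\<dots> \<le> 3 * w * \<alpha>"
  proof -
    have "real_of_int hi \<le> real n * (real t - 1) / 2 + w" "real n * (real t - 1) / 2 - w \<le> real_of_int lo"
      unfolding hi_def lo_def by linarith+
    then have "real (card {lo..hi}) \<le> 3 * w"
      using w by (simp add: of_nat_nat)
    then show ?thesis by (simp add: mult_right_mono)
  qed
  finally have near: "real (card ?near) \<le> 3 * w * \<alpha>" .
  have "real t ^ n = real (card (grid t I))"
    using I by (simp add: card_PiE n_def)
  also have "grid t I = ?near \<union> ?far" by auto
  also have "real (card (?near \<union> ?far)) \<le> real (card ?near) + real (card ?far)"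
    using card_Un_le[of ?near ?far] by linarith
  finally have "real t ^ n \<le> 3 * w * \<alpha> + real t ^ n / 4"
    using near far by linarith
  moreover have "0 \<le> w * \<alpha>" using w by simp
  ultimately have "real t ^ n \<le> 6 * (w * \<alpha>)"
    by linarith
  then show ?thesis by (simp add: n_def w_def mult_ac)
qed

section \<open>Counting antichains along two chain decompositions\<close>

text \<open>These are the antichains of the product of the chains \<open>A\<close> and \<open>B\<close>.\<close>

definition decreasing_sets :: "nat set \<Rightarrow> nat set \<Rightarrow> (nat \<times> nat) set set" where
  "decreasing_sets A B = {S. S \<subseteq> A \<times> B \<and> (\<forall>p\<in>S. \<forall>q\<in>S. fst p < fst q \<longleftrightarrow> snd q < snd p)}"

lemma decreasing_setsD:
  assumes "S \<in> decreasing_sets A B" "p \<in> S" "q \<in> S"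
  shows "fst p < fst q \<longleftrightarrow> snd q < snd p"
  using assms unfolding decreasing_sets_def by blast

lemma decreasing_sets_inj:
  assumes "S \<in> decreasing_sets A B"
  shows "inj_on fst S" "inj_on snd S"
proof -
  show "inj_on fst S"
  proof (rule inj_onI)
    fix p q assume pq: "p \<in> S" "q \<in> S" "fst p = fst q"
    then show "p = q"
      using decreasing_setsD[OF assms pq(1,2)] decreasing_setsD[OF assms pq(2,1)]
      by (simp add: prod_eq_iff)
  qed
  show "inj_on snd S"
  proof (rule inj_onI)
    fix p q assume pq: "p \<in> S" "q \<in> S" "snd p = snd q"
    then show "p = q"
      using decreasing_setsD[OF assms pq(1,2)] decreasing_setsD[OF assms pq(2,1)]
      by (simp add: prod_eq_iff)
  qed
qed

text \<open>
  A decreasing set is determined by its two projections, because the pairing of their elements can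
  be read off from their ranks.
\<close>

lemma decreasing_sets_rank:
  assumes S: "S \<in> decreasing_sets A B" and p: "p \<in> S"
  shows "card {c \<in> fst ` S. c < fst p} = card {d \<in> snd ` S. snd p < d}"
proof -
  have "{c \<in> fst ` S. c < fst p} = fst ` {r \<in> S. fst r < fst p}" by auto
  also have "card \<dots> = card {r \<in> S. fst r < fst p}"
    using decreasing_sets_inj(1)[OF S] by (intro card_image) (auto intro: inj_on_subset)
  also have "{r \<in> S. fst r < fst p} = {r \<in> S. snd p < snd r}"
    using decreasing_setsD[OF S _ p] by blast
  also have "card {r \<in> S. snd p < snd r} = card (snd ` {r \<in> S. snd p < snd r})"
    using decreasing_sets_inj(2)[OF S] by (intro card_image[symmetric]) (auto intro: inj_on_subset)
  also have "snd ` {r \<in> S. snd p < snd r} = {d \<in> snd ` S. snd p < d}" by auto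
  finally show ?thesis .
qed

lemma decreasing_sets_finite: "finite A \<Longrightarrow> finite B \<Longrightarrow> S \<in> decreasing_sets A B \<Longrightarrow> finite S"
  unfolding decreasing_sets_def by (auto intro: finite_subset)

lemma card_greater_eq_imp_eq:
  fixes Y :: "nat set"
  assumes "finite Y" "u \<in> Y" "v \<in> Y" "card {d \<in> Y. u < d} = card {d \<in> Y. v < d}"
  shows "u = v"
proof -
  have "\<not> u < v" if "u \<in> Y" "v \<in> Y" "card {d \<in> Y. u < d} = card {d \<in> Y. v < d}" for u v
  proof
    assume "u < v"
    then have "{d \<in> Y. v < d} \<subset> {d \<in> Y. u < d}"
      using that by auto
    from psubset_card_mono[OF _ this] show False
      using assms(1) that(3) by simp
  qed
  from this[OF assms(2-4)] this[OF assms(3,2) assms(4)[symmetric]] show ?thesis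
    by simp
qed

lemma decreasing_sets_determined:
  assumes fin: "finite A" "finite B"
    and S: "S \<in> decreasing_sets A B" and S': "S' \<in> decreasing_sets A B"
    and fst: "fst ` S = fst ` S'" and snd: "snd ` S = snd ` S'"
  shows "S \<subseteq> S'"
proof
  fix p assume p: "p \<in> S"
  then obtain q where q: "q \<in> S'" "fst q = fst p"
    using fst[symmetric] by (metis imageE imageI)
  \<comment> \<open>Both sides count the common first coordinates below
    \<open>fst p = fst q\<close>.\<close>
  have eq: "card {d \<in> snd ` S'. snd p < d} = card {d \<in> snd ` S'. snd q < d}"
    using decreasing_sets_rank[OF S p] decreasing_sets_rank[OF S' q(1)] q(2) fst snd by simp
  have mem: "snd p \<in> snd ` S'" "snd q \<in> snd ` S'"
    using p q snd by blast+
  have "finite (snd ` S')"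
    using decreasing_sets_finite[OF fin S'] by simp
  from card_greater_eq_imp_eq[OF this mem eq] q(2) have "p = q"
    by (simp add: prod_eq_iff)
  with q(1) show "p \<in> S'"
    by simp
qed

section \<open>The number of antichains in a product of two chains\<close>

lemma sum_exp_terms_le:
  fixes s :: real
  assumes "0 \<le> s"
  shows "(\<Sum>k\<le>N. s ^ k / fact k) \<le> exp s"
proof -
  have "(\<Sum>k\<le>N. s ^ k /\<^sub>R fact k) \<le> (\<Sum>k. s ^ k /\<^sub>R fact k)"
    using assms summable_exp_generic[of s] by (intro sum_le_suminf) auto
  then show ?thesis
    by (simp add: exp_def divide_inverse mult.commute)
qed

text \<open>Termwise, \<open>(a choose k) * (b choose k) \<le> (sqrt (a * b) ^ k / fact k)\<^sup>2\<close>.\<close>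

lemma sum_binomial_product_le:
  "(\<Sum>k\<le>N. real (a choose k) * real (b choose k)) \<le> exp (2 * sqrt (real a * real b))"
proof -
  define s where "s = sqrt (real a * real b)"
  define u where "u k = s ^ k / fact k" for k
  have s: "0 \<le> s" by (simp add: s_def)
  have u: "0 \<le> u k" for k using s by (simp add: u_def)
  have choose: "real (n choose k) \<le> real n ^ k / fact k" for n k
  proof -
    have "real ((n choose k) * fact k) \<le> real (n ^ k)"
      by (intro of_nat_mono binomial_fact_pow)
    then show ?thesis by (simp add: field_simps)
  qed
  have "(\<Sum>k\<le>N. real (a choose k) * real (b choose k)) \<le> (\<Sum>k\<le>N. u k * u k)"
  proof (rule sum_mono)
    fix k
    have "real (a choose k) * real (b choose k) \<le> (real a ^ k / fact k) * (real b ^ k / fact k)"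
      by (intro mult_mono choose) auto
    also have "\<dots> = (real a * real b) ^ k / (fact k * fact k)"
      by (simp add: power_mult_distrib)
    also have "real a * real b = s * s"
      by (simp add: s_def)
    finally show "real (a choose k) * real (b choose k) \<le> u k * u k"
      by (simp add: u_def power_mult_distrib)
  qed
  \<comment> \<open>The sum of squares is the diagonal part of the square of the sum, and all terms
    are nonnegative.\<close>
  also have "\<dots> \<le> (\<Sum>k\<le>N. u k * (\<Sum>l\<le>N. u l))"
    using u by (intro sum_mono mult_left_mono member_le_sum) auto
  also have "\<dots> = (\<Sum>k\<le>N. u k) * (\<Sum>k\<le>N. u k)"
    by (simp add: sum_distrib_right)
  also have "\<dots> \<le> exp s * exp s"
    using sum_exp_terms_le[OF s, of N] u by (intro mult_mono) (auto simp: u_def[symmetric] intro: sum_nonneg)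
  also have "\<dots> = exp (2 * s)"
    by (simp add: exp_double power2_eq_square)
  finally show ?thesis
    by (simp add: s_def)
qed

text \<open>Both projections are injective on a decreasing set, so its code is a pair of subsets of
  \<open>A\<close> and \<open>B\<close> of one common size \<open>k\<close>.\<close>

lemma card_decreasing_sets_le:
  assumes fin: "finite A" "finite B"
  shows "real (card (decreasing_sets A B)) \<le> exp (2 * sqrt (real (card A) * real (card B)))"
proof -
  let ?P = "\<lambda>k. {K. K \<subseteq> A \<and> card K = k} \<times> {K. K \<subseteq> B \<and> card K = k}"
  have "card (decreasing_sets A B) \<le> card (\<Union>k\<le>card A. ?P k)"
  proof (rule card_inj_on_le[where f = "\<lambda>S. (fst ` S, snd ` S)"])
    show "inj_on (\<lambda>S. (fst ` S, snd ` S)) (decreasing_sets A B)"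
    proof (rule inj_onI)
      fix S S' assume S: "S \<in> decreasing_sets A B" "S' \<in> decreasing_sets A B"
        and eq: "(fst ` S, snd ` S) = (fst ` S', snd ` S')"
      have eq': "fst ` S = fst ` S'" "snd ` S = snd ` S'" using eq by auto
      show "S = S'"
        using decreasing_sets_determined[OF fin S eq']
          decreasing_sets_determined[OF fin S(2,1) eq'[symmetric]] by (rule subset_antisym)
    qed
    show "(\<lambda>S. (fst ` S, snd ` S)) ` decreasing_sets A B \<subseteq> (\<Union>k\<le>card A. ?P k)"
    proof (rule image_subsetI)
      fix S assume S: "S \<in> decreasing_sets A B"
      then have sub: "fst ` S \<subseteq> A" "snd ` S \<subseteq> B"
        unfolding decreasing_sets_def by auto
      moreover have "card (fst ` S) = card S" "card (snd ` S) = card S"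
        using decreasing_sets_inj[OF S] by (simp_all add: card_image)
      moreover have "card (fst ` S) \<le> card A"
        using sub fin by (intro card_mono)
      ultimately show "(fst ` S, snd ` S) \<in> (\<Union>k\<le>card A. ?P k)"
        by auto
    qed
    show "finite (\<Union>k\<le>card A. ?P k)"
      using fin by auto
  qed
  also have "\<dots> \<le> (\<Sum>k\<le>card A. card (?P k))"
    by (rule card_UN_le) simp
  also have "\<dots> = (\<Sum>k\<le>card A. (card A choose k) * (card B choose k))"
    using fin by (simp add: card_cartesian_product n_subsets)
  finally have "real (card (decreasing_sets A B))
      \<le> real (\<Sum>k\<le>card A. (card A choose k) * (card B choose k))"
    by (rule of_nat_mono)
  also have "\<dots> \<le> exp (2 * sqrt (real (card A) * real (card B)))"
    using sum_binomial_product_le[where N = "card A" and a = "card A" and b = "card B"] by simp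
  finally show ?thesis .
qed

section \<open>Antichains encoded by their traces on pairs of chains\<close>

definition grid_antichains :: "nat \<Rightarrow> 'a set \<Rightarrow> ('a \<Rightarrow> nat) set set" where
  "grid_antichains t K =
    {S. S \<subseteq> grid t K \<and> (\<forall>x\<in>S. \<forall>y\<in>S. (\<forall>i\<in>K. x i \<le> y i) \<longrightarrow> x = y)}"

lemma grid_antichainsD:
  assumes "S \<in> grid_antichains t K"
  shows "x \<in> S \<Longrightarrow> x \<in> grid t K"
    and "x \<in> S \<Longrightarrow> y \<in> S \<Longrightarrow> \<forall>i\<in>K. x i \<le> y i \<Longrightarrow> x = y"
  using assms unfolding grid_antichains_def by blast+

text \<open>Each pair of labels cuts a cell out of the antichain. Replacing a point of the cell by
  its two partial ranks loses nothing and yields a decreasing set, so the count is at most a product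
  over label pairs. The exponent factors because
  \<open>sqrt (a * b) = sqrt a * sqrt b\<close>.\<close>

lemma card_grid_antichains_le:
  fixes \<phi> :: "('a \<Rightarrow> nat) \<Rightarrow> 'b" and \<psi> :: "('a \<Rightarrow> nat) \<Rightarrow> 'c"
  assumes I: "finite I" and J: "finite J"
    and \<phi>: "chain_label t I \<phi>" and \<psi>: "chain_label t J \<psi>"
  shows "real (card (grid_antichains t (I \<union> J))) \<le>
    exp (2 * ((\<Sum>c\<in>\<phi> ` grid t I. sqrt (card {x \<in> grid t I. \<phi> x = c})) *
              (\<Sum>d\<in>\<psi> ` grid t J. sqrt (card {x \<in> grid t J. \<psi> x = d}))))"
proof -
  let ?L = "\<phi> ` grid t I \<times> \<psi> ` grid t J"
  define FI where "FI c = {x \<in> grid t I. \<phi> x = c}" for c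
  define FJ where "FJ d = {x \<in> grid t J. \<psi> x = d}" for d
  define RI where "RI c = (\<lambda>x. sum x I) ` FI c" for c
  define RJ where "RJ d = (\<lambda>x. sum x J) ` FJ d" for d
  define cell where "cell S l = {x \<in> S. \<phi> (restrict x I) = fst l \<and> \<psi> (restrict x J) = snd l}" for S l
  define code where "code S = (\<lambda>l\<in>?L. (\<lambda>x. (sum x I, sum x J)) ` cell S l)" for S
  have fin: "finite (FI c)" "finite (FJ d)" "finite (RI c)" "finite (RJ d)" for c d
    using I J by (simp_all add: FI_def FJ_def RI_def RJ_def)
  have restr: "restrict x I \<in> grid t I" "restrict x J \<in> grid t J" if "x \<in> grid t (I \<union> J)" for x
    using that by (auto simp: restrict_PiE_iff PiE_iff)
  have sums: "sum (restrict x I) I = sum x I" "sum (restrict x J) J = sum x J" for x :: "'a \<Rightarrow> nat"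
    by (auto intro: sum.cong)
  \<comment> \<open>Within a cell the order of points can be read off their pairs of ranks.\<close>
  have le: "\<forall>i\<in>I \<union> J. x i \<le> y i"
    if "x \<in> grid t (I \<union> J)" "y \<in> grid t (I \<union> J)" "\<phi> (restrict x I) = \<phi> (restrict y I)"
      "\<psi> (restrict x J) = \<psi> (restrict y J)" "sum x I \<le> sum y I" "sum x J \<le> sum y J" for x y
  proof
    fix i assume "i \<in> I \<union> J"
    then show "x i \<le> y i"
      using chain_labelD[OF \<phi> restr(1)[OF that(1)] restr(1)[OF that(2)] that(3), of i]
        chain_labelD[OF \<psi> restr(2)[OF that(1)] restr(2)[OF that(2)] that(4), of i] that(5,6)
      by (auto simp: sums)
  qed
  have sub: "S \<subseteq> S'"
    if S: "S \<in> grid_antichains t (I \<union> J)" and S': "S' \<in> grid_antichains t (I \<union> J)"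
      and eq: "code S = code S'" for S S'
  proof
    fix x assume x: "x \<in> S"
    then have xg: "x \<in> grid t (I \<union> J)" by (rule grid_antichainsD(1)[OF S])
    define l where "l = (\<phi> (restrict x I), \<psi> (restrict x J))"
    have l: "l \<in> ?L" using restr[OF xg] by (auto simp: l_def)
    have "(sum x I, sum x J) \<in> (\<lambda>x. (sum x I, sum x J)) ` cell S l"
      using x by (auto simp: cell_def l_def)
    also have "\<dots> = (\<lambda>x. (sum x I, sum x J)) ` cell S' l"
      using fun_cong[OF eq, of l] l by (simp add: code_def)
    finally obtain y where y: "y \<in> cell S' l" "sum x I = sum y I" "sum x J = sum y J"
      by blast
    have yS: "y \<in> S'" and lab: "\<phi> (restrict y I) = \<phi> (restrict x I)" "\<psi> (restrict y J) = \<psi> (restrict x J)"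
      using y(1) by (auto simp: cell_def l_def)
    have yg: "y \<in> grid t (I \<union> J)" using yS by (rule grid_antichainsD(1)[OF S'])
    have "\<forall>i\<in>I \<union> J. x i \<le> y i" "\<forall>i\<in>I \<union> J. y i \<le> x i"
      using le[OF xg yg lab[symmetric]] le[OF yg xg lab] y(2,3) by simp_all
    then have "x = y"
      by (intro PiE_ext[OF xg yg]) (simp add: order.antisym)
    then show "x \<in> S'" using yS by simp
  qed
  have cells: "(\<lambda>x. (sum x I, sum x J)) ` cell S l \<in> decreasing_sets (RI (fst l)) (RJ (snd l))"
    if S: "S \<in> grid_antichains t (I \<union> J)" for S l
  proof -
    have g: "x \<in> S" "x \<in> grid t (I \<union> J)" "\<phi> (restrict x I) = fst l" "\<psi> (restrict x J) = snd l"
      if "x \<in> cell S l" for x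
      using that grid_antichainsD(1)[OF S] by (auto simp: cell_def)
    have 1: "sum x I \<in> RI (fst l)" "sum x J \<in> RJ (snd l)" if "x \<in> cell S l" for x
    proof -
      have F: "restrict x I \<in> FI (fst l)" "restrict x J \<in> FJ (snd l)"
        unfolding FI_def FJ_def using restr[OF g(2)[OF that]] g(3,4)[OF that] by blast+
      show "sum x I \<in> RI (fst l)"
        unfolding RI_def by (rule image_eqI[OF _ F(1)]) (simp only: sums)
      show "sum x J \<in> RJ (snd l)"
        unfolding RJ_def by (rule image_eqI[OF _ F(2)]) (simp only: sums)
    qed
    \<comment> \<open>Weak inequality in both ranks means comparability, which the antichain forbids
      for distinct points; the contrapositive gives both directions of the decreasing
      condition.\<close>
    have 2: "x = y" if xy: "x \<in> cell S l" "y \<in> cell S l" "sum x I \<le> sum y I" "sum x J \<le> sum y J" for x y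
      using g[OF xy(1)] g[OF xy(2)] xy(3,4)
      by (intro grid_antichainsD(2)[OF S] le) simp_all
    have "sum x I < sum y I \<longleftrightarrow> sum y J < sum x J" if xy: "x \<in> cell S l" "y \<in> cell S l" for x y
    proof
      assume "sum x I < sum y I"
      then show "sum y J < sum x J"
        using 2[OF xy] by (metis less_imp_le not_le)
    next
      assume "sum y J < sum x J"
      then show "sum x I < sum y I"
        using 2[OF xy(2,1)] by (metis less_imp_le not_le)
    qed
    with 1 show ?thesis
      unfolding decreasing_sets_def by auto
  qed
  have "card (grid_antichains t (I \<union> J)) \<le> card (\<Pi>\<^sub>E l\<in>?L. decreasing_sets (RI (fst l)) (RJ (snd l)))"
  proof (rule card_inj_on_le[where f = code])
    show "inj_on code (grid_antichains t (I \<union> J))"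
      using sub by (intro inj_onI) (simp add: subset_antisym)
    show "code ` grid_antichains t (I \<union> J) \<subseteq> (\<Pi>\<^sub>E l\<in>?L. decreasing_sets (RI (fst l)) (RJ (snd l)))"
      unfolding code_def by (intro image_subsetI restrict_PiE_iff[THEN iffD2] ballI cells)
    have "finite (decreasing_sets (RI c) (RJ d))" for c d
      by (rule finite_subset[of _ "Pow (RI c \<times> RJ d)"]) (auto simp: decreasing_sets_def fin)
    then show "finite (\<Pi>\<^sub>E l\<in>?L. decreasing_sets (RI (fst l)) (RJ (snd l)))"
      using I J by (intro finite_PiE) auto
  qed
  also have "\<dots> = (\<Prod>l\<in>?L. card (decreasing_sets (RI (fst l)) (RJ (snd l))))"
    using I J by (intro card_PiE) simp
  finally have "real (card (grid_antichains t (I \<union> J)))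
      \<le> real (\<Prod>l\<in>?L. card (decreasing_sets (RI (fst l)) (RJ (snd l))))"
    by (rule of_nat_mono)
  also have "\<dots> = (\<Prod>l\<in>?L. real (card (decreasing_sets (RI (fst l)) (RJ (snd l)))))"
    by simp
  also have "\<dots> \<le> (\<Prod>l\<in>?L. exp (2 * (sqrt (card (FI (fst l))) * sqrt (card (FJ (snd l))))))"
  proof (rule prod_mono, intro conjI)
    fix l
    have "real (card (decreasing_sets (RI (fst l)) (RJ (snd l))))
        \<le> exp (2 * sqrt (real (card (RI (fst l))) * real (card (RJ (snd l)))))"
      by (rule card_decreasing_sets_le[OF fin(3,4)])
    also have "\<dots> \<le> exp (2 * sqrt (real (card (FI (fst l))) * real (card (FJ (snd l)))))"
      using card_image_le[OF fin(1)] card_image_le[OF fin(2)]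
      by (auto simp: RI_def RJ_def intro!: mult_mono)
    finally show "real (card (decreasing_sets (RI (fst l)) (RJ (snd l))))
        \<le> exp (2 * (sqrt (card (FI (fst l))) * sqrt (card (FJ (snd l)))))"
      by (simp add: real_sqrt_mult)
  qed simp
  also have "\<dots> = exp (\<Sum>l\<in>?L. 2 * (sqrt (card (FI (fst l))) * sqrt (card (FJ (snd l)))))"
    using I J by (intro exp_sum[symmetric]) simp
  also have "(\<Sum>l\<in>?L. 2 * (sqrt (card (FI (fst l))) * sqrt (card (FJ (snd l)))))
      = 2 * ((\<Sum>c\<in>\<phi> ` grid t I. sqrt (card (FI c))) * (\<Sum>d\<in>\<psi> ` grid t J. sqrt (card (FJ d))))"
    unfolding sum_product sum.cartesian_product by (simp only: sum_distrib_left case_prod_beta)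
  finally show ?thesis
    by (simp add: FI_def FJ_def)
qed

section \<open>Combination of the estimates\<close>

text \<open>Cauchy-Schwarz against the constant 1 on the labels; the fibre sizes add up to
  \<open>card X\<close>.\<close>

lemma sum_sqrt_fibres_le:
  assumes "finite X"
  shows "(\<Sum>c\<in>\<phi> ` X. sqrt (card {x \<in> X. \<phi> x = c}))\<^sup>2 \<le> real (card X) * real (card (\<phi> ` X))"
proof -
  have "(\<Sum>c\<in>\<phi> ` X. sqrt (card {x \<in> X. \<phi> x = c}))\<^sup>2
      \<le> (\<Sum>c\<in>\<phi> ` X. (sqrt (card {x \<in> X. \<phi> x = c}))\<^sup>2) * card (\<phi> ` X)"
    by (rule sum_squared_le_sum_of_squares)
  also have "(\<Sum>c\<in>\<phi> ` X. (sqrt (card {x \<in> X. \<phi> x = c}))\<^sup>2) = (\<Sum>c\<in>\<phi> ` X. \<Sum>x\<in>{x \<in> X. \<phi> x = c}. 1)"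
    by simp
  also have "\<dots> = (\<Sum>x\<in>X. 1)"
    using sum.image_gen[OF assms, of "\<lambda>_. 1::real" \<phi>] by simp
  finally show ?thesis by simp
qed

text \<open>Cauchy-Schwarz bounds the square by \<open>t ^ card I\<close> times the number of
  chains, and the middle level bounds that number by
  \<open>3 * t ^ (card I - 1) / sqrt (card I)\<close>. Denominators are multiplied out.\<close>

lemma chain_label_sum_sqrt_le:
  assumes I: "finite I" "I \<noteq> {}" and t: "2 \<le> t"
  obtains \<phi> :: "('a \<Rightarrow> nat) \<Rightarrow> ('a \<Rightarrow> nat)" where "chain_label t I \<phi>"
    "(\<Sum>c\<in>\<phi> ` grid t I. sqrt (card {x \<in> grid t I. \<phi> x = c}))\<^sup>2 * (real t * sqrt (card I))
      \<le> 3 * (real t ^ card I)\<^sup>2"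
proof -
  obtain \<phi> :: "('a \<Rightarrow> nat) \<Rightarrow> ('a \<Rightarrow> nat)" where \<phi>: "chain_label t I \<phi>"
    "card (\<phi> ` grid t I) \<le> card {x \<in> grid t I. sum x I = card I * (t - 1) div 2}"
    by (rule chain_label_middle[OF I(1)])
  let ?p = "real (card (\<phi> ` grid t I))"
  obtain k where k: "card I = Suc k"
    using I by (metis card_eq_0_iff not0_implies_Suc)
  have "?p * sqrt (card I)
      \<le> real (card {x \<in> grid t I. sum x I = card I * (t - 1) div 2}) * sqrt (card I)"
    using \<phi>(2) by (intro mult_right_mono) auto
  also have "\<dots> \<le> 3 * real t ^ (card I - 1)"
    by (rule card_level_le[OF I t])
  finally have p: "real t * (?p * sqrt (card I)) \<le> 3 * real t ^ card I"
    using mult_left_mono[of "?p * sqrt (card I)" "3 * real t ^ (card I - 1)" "real t"]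
    by (simp add: k mult_ac)
  have "(\<Sum>c\<in>\<phi> ` grid t I. sqrt (card {x \<in> grid t I. \<phi> x = c}))\<^sup>2 * (real t * sqrt (card I))
      \<le> (real t ^ card I * ?p) * (real t * sqrt (card I))"
    using sum_sqrt_fibres_le[OF finite_grid[OF I(1)], where \<phi> = \<phi>] I
    by (intro mult_right_mono) (auto simp: card_grid)
  also have "\<dots> = real t ^ card I * (real t * (?p * sqrt (card I)))"
    by (simp only: mult_ac)
  also have "\<dots> \<le> real t ^ card I * (3 * real t ^ card I)"
    using p by (intro mult_left_mono) auto
  also have "\<dots> = 3 * (real t ^ card I)\<^sup>2"
    by (simp add: power2_eq_square)
  finally show thesis
    using that \<phi>(1) by blast
qed

lemma antichains_eq: "antichains t n = grid_antichains t {..<n}"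
  unfolding antichains_def grid_antichains_def hypergrid_def grid_le_def
  by (intro Collect_cong conj_cong ball_cong refl) (auto simp: Ball_def)

lemma card_level_le_max_antichain:
  "card {x \<in> grid t {..<n}. sum x {..<n} = k} \<le> max_antichain_size t n"
proof -
  let ?S = "{x \<in> grid t {..<n}. sum x {..<n} = k}"
  have "x = y" if x: "x \<in> ?S" and y: "y \<in> ?S" and le: "\<forall>i\<in>{..<n}. x i \<le> y i" for x y
  proof (rule PiE_ext)
    show "x \<in> grid t {..<n}" "y \<in> grid t {..<n}" using x y by auto
    show "x i = y i" if "i \<in> {..<n}" for i
      by (rule sum_mono_inv[of x "{..<n}" y]) (use x y le that in auto)
  qed
  then have "?S \<in> antichains t n"
    unfolding antichains_eq grid_antichains_def by blast
  then show ?thesis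
    unfolding max_antichain_size_def by (intro Max_ge finite_imageI finite_antichains imageI)
qed

lemma power_le_max_antichain:
  assumes "1 \<le> n" "1 \<le> t"
  shows "real t ^ n \<le> 6 * real t * sqrt n * real (max_antichain_size t n)"
proof -
  have "{..<n} \<noteq> {}" using assms by (auto simp: lessThan_empty_iff)
  from power_le_if_levels_le[OF finite_lessThan assms(2) this card_level_le_max_antichain] show ?thesis
    by simp
qed

lemma ln_num_antichains_le:
  assumes n: "2 \<le> n" and t: "2 \<le> t"
  shows "ln (real (num_antichains t n)) \<le> 64 * real (max_antichain_size t n)"
proof -
  define a where "a = n div 2"
  define I where "I = {..<a}"
  define J where "J = {a..<n}"
  have a: "1 \<le> a" "a < n" using n by (auto simp: a_def)
  have fin: "finite I" "finite J" "I \<noteq> {}" "J \<noteq> {}" "I \<union> J = {..<n}" "card I = a" "card J = n - a"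
    using a by (auto simp: I_def J_def lessThan_empty_iff)
  obtain \<phi> :: "(nat \<Rightarrow> nat) \<Rightarrow> (nat \<Rightarrow> nat)" where \<phi>: "chain_label t I \<phi>"
    "(\<Sum>c\<in>\<phi> ` grid t I. sqrt (card {x \<in> grid t I. \<phi> x = c}))\<^sup>2 * (real t * sqrt (card I))
      \<le> 3 * (real t ^ card I)\<^sup>2"
    by (rule chain_label_sum_sqrt_le[OF fin(1,3) t])
  obtain \<psi> :: "(nat \<Rightarrow> nat) \<Rightarrow> (nat \<Rightarrow> nat)" where \<psi>: "chain_label t J \<psi>"
    "(\<Sum>c\<in>\<psi> ` grid t J. sqrt (card {x \<in> grid t J. \<psi> x = c}))\<^sup>2 * (real t * sqrt (card J))
      \<le> 3 * (real t ^ card J)\<^sup>2"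
    by (rule chain_label_sum_sqrt_le[OF fin(2,4) t])
  define X where "X = (\<Sum>c\<in>\<phi> ` grid t I. sqrt (card {x \<in> grid t I. \<phi> x = c}))"
  define Y where "Y = (\<Sum>c\<in>\<psi> ` grid t J. sqrt (card {x \<in> grid t J. \<psi> x = c}))"
  let ?\<alpha> = "real (max_antichain_size t n)"
  have X: "X\<^sup>2 * (real t * sqrt a) \<le> 3 * (real t ^ a)\<^sup>2"
    using \<phi>(2) by (simp add: X_def fin)
  have Y: "Y\<^sup>2 * (real t * sqrt (n - a)) \<le> 3 * (real t ^ (n - a))\<^sup>2"
    using \<psi>(2) by (simp add: Y_def fin)
  have pow: "real t ^ n = real t ^ a * real t ^ (n - a)"
    using a by (simp add: power_add[symmetric])
  \<comment> \<open>Both halves have at least \<open>n / 3\<close> coordinates, with equality for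
    the smaller one at \<open>n = 3\<close>.\<close>
  have sq: "real n / 3 \<le> sqrt a * sqrt (n - a)"
  proof -
    have "n \<le> 3 * a" "n \<le> 3 * (n - a)"
      using n unfolding a_def by linarith+
    then have "real n / 3 \<le> real a" "real n / 3 \<le> real (n - a)"
      by linarith+
    then have "sqrt (real n / 3) * sqrt (real n / 3) \<le> sqrt a * sqrt (n - a)"
      by (intro mult_mono) auto
    then show ?thesis by simp
  qed
  have "(X * Y)\<^sup>2 * ((real t)\<^sup>2 * (real n / 3)) \<le> (X * Y)\<^sup>2 * ((real t)\<^sup>2 * (sqrt a * sqrt (n - a)))"
    using sq by (intro mult_left_mono) auto
  also have "\<dots> = (X\<^sup>2 * (real t * sqrt a)) * (Y\<^sup>2 * (real t * sqrt (n - a)))"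
    by (simp add: power2_eq_square mult_ac)
  also have "\<dots> \<le> (3 * (real t ^ a)\<^sup>2) * (3 * (real t ^ (n - a))\<^sup>2)"
    by (rule mult_mono[OF X Y]) auto
  also have "\<dots> = 9 * (real t ^ n)\<^sup>2"
    unfolding pow by (simp add: power_mult_distrib)
  also have "\<dots> \<le> 9 * (6 * real t * sqrt n * ?\<alpha>)\<^sup>2"
    using power_le_max_antichain[of n t] n t by (intro mult_left_mono power_mono) auto
  \<comment> \<open>\<open>972 = 9 * 36 * 3\<close>: the two chain bounds give 9, the squared lower
    bound for the largest antichain gives 36, and 3 makes up for the factor
    \<open>real n / 3\<close>. As \<open>972 \<le> 32^2\<close>, the exponent
    \<open>2 * (X * Y)\<close> is at most 64 times the largest antichain size.\<close>
  also have "\<dots> = 972 * ?\<alpha>\<^sup>2 * ((real t)\<^sup>2 * (real n / 3))"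
    by (simp add: power_mult_distrib)
  finally have "(X * Y)\<^sup>2 \<le> 972 * ?\<alpha>\<^sup>2"
    using n t by (simp add: mult_le_cancel_right)
  also have "\<dots> \<le> (32 * ?\<alpha>)\<^sup>2"
    by (simp add: power_mult_distrib)
  finally have XY: "X * Y \<le> 32 * ?\<alpha>"
    by (rule power2_le_imp_le) simp
  have "{} \<in> antichains t n"
    by (rule empty_in_antichains)
  then have pos: "0 < num_antichains t n"
    unfolding num_antichains_def using finite_antichains by (auto simp: card_gt_0_iff)
  have "real (num_antichains t n) \<le> exp (2 * (X * Y))"
    using card_grid_antichains_le[OF fin(1,2) \<phi>(1) \<psi>(1)]
    by (simp add: num_antichains_def antichains_eq fin X_def Y_def)
  then have "ln (real (num_antichains t n)) \<le> 2 * (X * Y)"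
    using pos by (metis exp_gt_zero ln_exp ln_le_cancel_iff of_nat_0_less_iff)
  then show ?thesis using XY by linarith
qed

theorem theorem2p1:
  shows "\<exists>C::real. C > 0 \<and> (\<forall>n t::nat. n \<ge> 2 \<longrightarrow> t \<ge> 2 \<longrightarrow>
    log 2 (real (num_antichains t n)) \<le> C * real (max_antichain_size t n))"
proof (intro exI[of _ "64 / ln 2"] conjI allI impI)
  fix n t :: nat
  assume "2 \<le> n" "2 \<le> t"
  then have "ln (real (num_antichains t n)) / ln 2 \<le> 64 * real (max_antichain_size t n) / ln 2"
    by (intro divide_right_mono ln_num_antichains_le) auto
  then show "log 2 (real (num_antichains t n)) \<le> 64 / ln 2 * real (max_antichain_size t n)"
    by (simp add: log_def)
qed simp

end
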